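(* Let $n\in\mathbb N$, let $H$ be a symmetry group on $\mathbb Z^d$ and $M$ a $d\times d$ matrix dilation with set of digits $D(M)=\{s_0,\dots,s_{m-1}\}$, $m=|\det M|$, such that: (i) $MEM^{-1}\in H$ for all $E\in H$; (ii) for all $E\in H$ and $j=0,\dots,m-1$ one has $Es_j=Mr_j^E+s_j$ with some $r_j^E\in\mathbb Z^d$; (iii) for every $j$, $\sigma_j:=M^{-1}s_j-\lfloor M^{-1}s_j\rfloor$ belongs to $\frac12\mathbb Z^d\cap[0,\frac12]^d$, and for each $E\in H$ and any trigonometric polynomial $t(\xi)$ of semi-integer degrees associated with $\sigma_j$, $t(E^*\xi)$ is again a trigonometric polynomial of semi-integer degrees associated with $\sigma_j$. Then there exist masks $m_0$ and $\widetilde m_0$ that are $H$-symmetric with respect to the origin, such that $m_0$ has sum rule of order $n$ (with respect to $M$) and $\widetilde m_0$ satisfies $$D^\beta\big(1-m_0(\xi)\overline{\widetilde m_0(\xi)}\big)\Big|_{\xi=\mathbf 0}=0\qquad\forall\beta\in\Delta_n.$$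
   Context: A symmetry group on $\mathbb Z^d$ is a finite set $H$ of integer $d\times d$ matrices with $|\det E|=1$ for $E\in H$ that forms a group under matrix multiplication. A matrix dilation $M$ is an integer $d\times d$ matrix all of whose eigenvalues are bigger than 1 in modulus; $M^*$ is its conjugate (transpose). A set of digits contains exactly one representative of each coset of $\mathbb Z^d/M\mathbb Z^d$. The floor $\lfloor\cdot\rfloor$ of a vector is coordinatewise; $[\alpha]=\sum_j\alpha_j$, $\Delta_n=\{\alpha\in\mathbb Z^d_+:[\alpha]<n\}$. A trigonometric polynomial of semi-integer degrees associated with $\sigma\in\frac12\mathbb Z^d\cap[0,\frac12]^d$ is a finite sum $\sum_{k\in\mathbb Z^d}h_ke^{2\pi i(k+\sigma,\xi)}$, $h_k\in\mathbb C$; a trigonometric polynomial is the case $\sigma=\mathbf 0$. A mask is a trigonometric polynomial equal to 1 at $\mathbf 0$. A trigonometric polynomial $t$ is $H$-symmetric with respect to the origin if $t(\xi)=t(E^*\xi)$ for all $E\in H$. $t$ has sum rule of order $n$ with respect to $M$ if $D^\beta(t(M^{*-1}\xi))|_{\xi=s}=0$ for all $s\in D(M^* )\setminus\{\mathbf 0\}$, $\beta\in\Delta_n$ (where $D(M^* )$ is a set of digits of $M^*$ containing $\mathbf 0$). *)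

theory Defs
  imports "HOL-Analysis.Analysis" "HOL-Algebra.Group"
begin

definition rvec :: "int ^ 'd \<Rightarrow> real ^ 'd" where
  "rvec k = (\<chi> i. real_of_int (k $ i))"

definition rmat :: "int ^ 'd ^ 'd \<Rightarrow> real ^ 'd ^ 'd" where
  "rmat = map_matrix real_of_int"

definition vfloor :: "real ^ 'd \<Rightarrow> int ^ 'd" where
  "vfloor x = (\<chi> i. \<lfloor>x $ i\<rfloor>)"

definition symmetry_group :: "(int ^ 'd ^ 'd) set \<Rightarrow> bool" where
  "symmetry_group H \<longleftrightarrow>
     finite H \<and> (\<forall>E\<in>H. \<bar>det E\<bar> = 1) \<and>
     group \<lparr>carrier = H, monoid.mult = (**), one = mat 1\<rparr>"

definition matrix_eigenvalue :: "complex ^ 'd ^ 'd \<Rightarrow> complex \<Rightarrow> bool" where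
  "matrix_eigenvalue A c \<longleftrightarrow> (\<exists>v. v \<noteq> 0 \<and> A *v v = c *s v)"

definition matrix_dilation :: "int ^ 'd ^ 'd \<Rightarrow> bool" where
  "matrix_dilation M \<longleftrightarrow> (\<forall>c. matrix_eigenvalue (map_matrix of_int M) c \<longrightarrow> cmod c > 1)"

definition digit_set :: "int ^ 'd ^ 'd \<Rightarrow> (int ^ 'd) set \<Rightarrow> bool" where
  "digit_set M D \<longleftrightarrow> (\<forall>x. \<exists>!s. s \<in> D \<and> (\<exists>k. x - s = M *v k))"

text \<open>Digit sets containing the origin always exist, so the quantification over them in the
  definition of the sum rule below is never vacuous.\<close>

lemma digit_set_exists: "\<exists>D. digit_set M D \<and> 0 \<in> D"
proof -
  define R where "R x y \<longleftrightarrow> (\<exists>k. x - y = M *v k)" for x y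
  have R_refl: "R x x" for x
    unfolding R_def by (rule exI[of _ 0]) simp
  have R_sym: "R y x" if "R x y" for x y
  proof -
    from that obtain k where "x - y = M *v k" by (auto simp: R_def)
    moreover have "M *v (- k) = - (M *v k)"
      by (simp add: vec_eq_iff matrix_vector_mult_def sum_negf)
    ultimately have "y - x = M *v (- k)"
      by (simp flip: minus_diff_eq[of x y])
    then show ?thesis by (auto simp: R_def)
  qed
  have R_trans: "R x z" if "R x y" "R y z" for x y z
  proof -
    from that obtain k l where "x - y = M *v k" "y - z = M *v l" by (auto simp: R_def)
    moreover have "x - z = (x - y) + (y - z)" by simp
    ultimately have "x - z = M *v (k + l)"
      by (simp only: matrix_vector_right_distrib)
    then show ?thesis by (auto simp: R_def)
  qed
  define f where "f x = (if R x 0 then 0 else (SOME y. R x y))" for x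
  have Rf: "R x (f x)" for x
    by (cases "R x 0") (auto simp: f_def intro: someI[of "R x", OF R_refl])
  have feq: "f x = f y" if "R x y" for x y
  proof -
    have "R x = R y" using that R_sym R_trans by blast
    then show ?thesis by (simp add: f_def)
  qed
  have "digit_set M (range f)"
    unfolding digit_set_def R_def[symmetric]
  proof
    fix x
    show "\<exists>!s. s \<in> range f \<and> R x s"
    proof (rule ex1I[of _ "f x"])
      show "f x \<in> range f \<and> R x (f x)" by (simp add: Rf)
    next
      fix s assume "s \<in> range f \<and> R x s"
      then obtain y where y: "s = f y" "R x s" by blast
      have "R x y" using y R_trans R_sym Rf by blast
      then show "s = f x" using feq y(1) by simp
    qed
  qed
  moreover have "f 0 = 0" by (simp add: f_def R_refl)
  ultimately show ?thesis by (metis rangeI)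
qed

definition partial_deriv :: "'d \<Rightarrow> (real ^ 'd \<Rightarrow> complex) \<Rightarrow> real ^ 'd \<Rightarrow> complex" where
  "partial_deriv i f x = vector_derivative (\<lambda>t. f (x + t *\<^sub>R axis i 1)) (at 0)"

text \<open>The index type carries no order, so the mixed partial derivative is taken along a fixed but
  arbitrary enumeration of the coordinates. It is only applied to smooth functions, for which
  partial derivatives commute and the enumeration is irrelevant.\<close>

definition coords :: "'d::finite list" where
  "coords = (SOME xs. distinct xs \<and> set xs = UNIV)"

lemma coords: "distinct (coords :: 'd::finite list)" "set (coords :: 'd list) = UNIV"
proof -
  have "\<exists>xs :: 'd list. distinct xs \<and> set xs = UNIV"
    using finite_distinct_list[of "UNIV :: 'd set"] by auto
  from someI_ex[OF this]
  show "distinct (coords :: 'd list)" "set (coords :: 'd list) = UNIV"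
    by (simp_all add: coords_def)
qed

definition mixed_deriv :: "nat ^ 'd \<Rightarrow> (real ^ 'd \<Rightarrow> complex) \<Rightarrow> real ^ 'd \<Rightarrow> complex" where
  "mixed_deriv \<beta> f = foldr (\<lambda>i. partial_deriv i ^^ (\<beta> $ i)) coords f"

definition multi_indices_below :: "nat \<Rightarrow> (nat ^ 'd) set" where
  "multi_indices_below n = {\<alpha>. (\<Sum>i\<in>UNIV. \<alpha> $ i) < n}"

definition semi_integer_shifts :: "(real ^ 'd) set" where
  "semi_integer_shifts = {\<sigma>. \<forall>i. 2 * \<sigma> $ i \<in> \<int> \<and> 0 \<le> \<sigma> $ i \<and> \<sigma> $ i \<le> 1 / 2}"

definition semi_trig_poly :: "real ^ 'd \<Rightarrow> (real ^ 'd \<Rightarrow> complex) \<Rightarrow> bool" where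
  "semi_trig_poly \<sigma> t \<longleftrightarrow>
     (\<exists>(K :: (int ^ 'd) set) (h :: int ^ 'd \<Rightarrow> complex). finite K \<and>
        t = (\<lambda>\<xi>. \<Sum>k\<in>K. h k * exp (2 * of_real pi * \<i> * of_real ((rvec k + \<sigma>) \<bullet> \<xi>))))"

definition trig_poly :: "(real ^ 'd \<Rightarrow> complex) \<Rightarrow> bool" where
  "trig_poly t \<longleftrightarrow> semi_trig_poly 0 t"

definition mask :: "(real ^ 'd \<Rightarrow> complex) \<Rightarrow> bool" where
  "mask t \<longleftrightarrow> trig_poly t \<and> t 0 = 1"

definition H_symmetric :: "(int ^ 'd ^ 'd) set \<Rightarrow> (real ^ 'd \<Rightarrow> complex) \<Rightarrow> bool" where
  "H_symmetric H t \<longleftrightarrow> (\<forall>E\<in>H. \<forall>\<xi>. t \<xi> = t (transpose (rmat E) *v \<xi>))"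

text \<open>For a trigonometric polynomial, integer periodicity makes the condition below independent of
  the choice of the digit set of the transposed matrix, so all of them are required to satisfy it.\<close>

definition sum_rule :: "nat \<Rightarrow> int ^ 'd ^ 'd \<Rightarrow> (real ^ 'd \<Rightarrow> complex) \<Rightarrow> bool" where
  "sum_rule n M t \<longleftrightarrow>
     (\<forall>D. digit_set (transpose M) D \<and> 0 \<in> D \<longrightarrow>
        (\<forall>s\<in>D - {0}. \<forall>\<beta>\<in>multi_indices_below n.
           mixed_deriv \<beta> (\<lambda>\<xi>. t (matrix_inv (transpose (rmat M)) *v \<xi>)) (rvec s) = 0))"

definition digit_shift :: "int ^ 'd ^ 'd \<Rightarrow> int ^ 'd \<Rightarrow> real ^ 'd" where
  "digit_shift M s =
     matrix_inv (rmat M) *v rvec s - rvec (vfloor (matrix_inv (rmat M) *v rvec s))"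

end

theory Submission
  imports Defs
begin

text \<open>
  Write \<open>e(x)\<close> for \<open>exp (2 \<pi> \<i> x)\<close> and let \<open>D\<close> be the given digit set. The normalised digit
  polynomial \<open>Q(\<xi>)\<close>, the average of \<open>e(k \<bullet> \<xi>)\<close> over \<open>k \<in> D\<close>, equals 1 at the origin. At a point
  \<open>y\<close> whose image \<open>M\<^sup>T y\<close> is an integer vector, \<open>k \<mapsto> e(k \<bullet> y)\<close> is a character of the finite group
  \<open>\<int>\<^sup>d / M\<int>\<^sup>d\<close>, and it is nontrivial unless \<open>y\<close> itself is integral. Orthogonality of characters
  therefore gives \<open>Q(y) = 0\<close> at every point where the sum rule imposes a condition
  (\<open>digit_sum_eq_0\<close>).

  Hence \<open>P(\<xi>) = (\<Prod>E\<in>H. Q(E\<^sup>T \<xi>))\<close> vanishes at all these points, because of the factor with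
  \<open>E = 1\<close>, and it is invariant under \<open>H\<close>, because left multiplication permutes the group. The mask
  \<open>m\<^sub>0 = P^n\<close> then has a zero of order at least \<open>n\<close> wherever \<open>P\<close> vanishes, since each
  differentiation removes at most one factor \<open>P\<close> (\<open>mixed_deriv_power_eq_0\<close>).

  A dual mask comes from the geometric series: with \<open>r = (\<Sum>k\<le>n. (1 - m\<^sub>0)^k)\<close> one has
  \<open>1 - m\<^sub>0 r = (1 - m\<^sub>0)^(n + 1)\<close>, which vanishes to order \<open>n + 1\<close> at the origin because
  \<open>m\<^sub>0(0) = 1\<close>. So the second mask is the complex conjugate of \<open>r\<close>; it inherits symmetry from
  \<open>m\<^sub>0\<close>, being a function of it.
\<close>

section \<open>Exponential sums\<close>

definition echar :: "real \<Rightarrow> complex" where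
  "echar x = exp (2 * of_real pi * \<i> * of_real x)"

lemma echar_0 [simp]: "echar 0 = 1"
  by (simp add: echar_def)

lemma echar_add: "echar (x + y) = echar x * echar y"
  by (simp add: echar_def ring_distribs exp_add)

lemma echar_minus: "echar (- x) = cnj (echar x)"
  by (simp add: echar_def exp_cnj)

lemma echar_eq_1_iff: "echar x = 1 \<longleftrightarrow> x \<in> \<int>"
proof -
  have "echar x = 1 \<longleftrightarrow> (\<exists>n::int. 2 * pi * x = of_int (2 * n) * pi)"
    by (simp add: echar_def exp_eq_1)
  also have "\<dots> \<longleftrightarrow> (\<exists>n::int. x = of_int n)"
    by simp
  finally show ?thesis
    by (auto simp: Ints_def)
qed

text \<open>The algebra generated by the exponentials with frequencies in \<open>A\<close>. Integer frequencies give
  the trigonometric polynomials, but the substitution of \<open>M\<^sup>-\<^sup>T \<xi>\<close> in the sum rule leads to arbitrary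
  real frequencies, so \<open>A\<close> is kept as a parameter.\<close>

inductive exp_sum :: "(real ^ 'd) set \<Rightarrow> (real ^ 'd \<Rightarrow> complex) \<Rightarrow> bool" for A where
  const: "exp_sum A (\<lambda>_. c)"
| echar: "a \<in> A \<Longrightarrow> exp_sum A (\<lambda>x. echar (a \<bullet> x))"
| add: "exp_sum A f \<Longrightarrow> exp_sum A g \<Longrightarrow> exp_sum A (\<lambda>x. f x + g x)"
| mult: "exp_sum A f \<Longrightarrow> exp_sum A g \<Longrightarrow> exp_sum A (\<lambda>x. f x * g x)"

lemma exp_sum_diff:
  assumes "exp_sum A f" "exp_sum A g"
  shows "exp_sum A (\<lambda>x. f x - g x)"
  using exp_sum.add[OF assms(1) exp_sum.mult[OF exp_sum.const[of A "-1"] assms(2)]] by simp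

lemma exp_sum_power: "exp_sum A f \<Longrightarrow> exp_sum A (\<lambda>x. f x ^ k)"
  by (induction k) (auto intro: exp_sum.intros)

lemma exp_sum_sum:
  "(\<And>i. i \<in> I \<Longrightarrow> exp_sum A (f i)) \<Longrightarrow> exp_sum A (\<lambda>x. \<Sum>i\<in>I. f i x)"
  by (induction I rule: infinite_finite_induct) (auto intro: exp_sum.intros)

lemma exp_sum_prod:
  "(\<And>i. i \<in> I \<Longrightarrow> exp_sum A (f i)) \<Longrightarrow> exp_sum A (\<lambda>x. \<Prod>i\<in>I. f i x)"
  by (induction I rule: infinite_finite_induct) (auto intro: exp_sum.intros)

lemma exp_sum_cnj:
  assumes "exp_sum A f" "\<And>a. a \<in> A \<Longrightarrow> - a \<in> A"
  shows "exp_sum A (\<lambda>x. cnj (f x))"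
  using assms(1)
proof induction
  case (echar a)
  then have "exp_sum A (\<lambda>x. echar (- a \<bullet> x))"
    by (intro exp_sum.echar assms(2))
  then show ?case
    by (simp add: echar_minus)
qed (auto intro: exp_sum.intros)

lemma exp_sum_compose_linear:
  assumes "exp_sum A f" "\<And>a. a \<in> A \<Longrightarrow> transpose L *v a \<in> B"
  shows "exp_sum B (\<lambda>x. f (L *v x))"
  using assms(1)
proof induction
  case (echar a)
  then have "exp_sum B (\<lambda>x. echar ((transpose L *v a) \<bullet> x))"
    by (intro exp_sum.echar assms(2))
  then show ?case
    by (simp add: dot_lmul_matrix)
qed (auto intro: exp_sum.intros)

section \<open>Exponential sums with integer frequencies\<close>

lemma trig_poly_iff:
  "trig_poly t \<longleftrightarrow> (\<exists>K h. finite K \<and> t = (\<lambda>\<xi>. \<Sum>k\<in>K. h k * echar (rvec k \<bullet> \<xi>)))"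
  by (simp add: trig_poly_def semi_trig_poly_def echar_def)

lemma trig_poly_monomial: "trig_poly (\<lambda>\<xi>. c * echar (rvec k \<bullet> \<xi>))"
  unfolding trig_poly_iff by (intro exI[of _ "{k}"] exI[of _ "\<lambda>_. c"]) simp

lemma trig_poly_add:
  assumes "trig_poly f" "trig_poly g"
  shows "trig_poly (\<lambda>\<xi>. f \<xi> + g \<xi>)"
proof -
  obtain K h where K: "finite K" "f = (\<lambda>\<xi>. \<Sum>k\<in>K. h k * echar (rvec k \<bullet> \<xi>))"
    using assms(1) unfolding trig_poly_iff by blast
  obtain L l where L: "finite L" "g = (\<lambda>\<xi>. \<Sum>k\<in>L. l k * echar (rvec k \<bullet> \<xi>))"
    using assms(2) unfolding trig_poly_iff by blast
  define c where "c k = (if k \<in> K then h k else 0) + (if k \<in> L then l k else 0)" for k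
  have "(\<Sum>k\<in>K \<union> L. c k * echar (rvec k \<bullet> \<xi>)) = f \<xi> + g \<xi>" for \<xi>
  proof -
    have "(\<Sum>k\<in>K \<union> L. c k * echar (rvec k \<bullet> \<xi>)) =
        (\<Sum>k\<in>K \<union> L. (if k \<in> K then h k * echar (rvec k \<bullet> \<xi>) else 0)) +
        (\<Sum>k\<in>K \<union> L. (if k \<in> L then l k * echar (rvec k \<bullet> \<xi>) else 0))"
      unfolding sum.distrib[symmetric] by (intro sum.cong) (auto simp: c_def ring_distribs)
    also have "\<dots> = f \<xi> + g \<xi>"
      using K L by (simp add: sum.If_cases Int_absorb1 Collect_conj_eq Int_Un_distrib2)
    finally show ?thesis .
  qed
  then show ?thesis
    unfolding trig_poly_iff using K(1) L(1)
    by (intro exI[of _ "K \<union> L"] exI[of _ c]) auto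
qed

lemma trig_poly_sum:
  "(\<And>i. i \<in> I \<Longrightarrow> trig_poly (f i)) \<Longrightarrow> trig_poly (\<lambda>\<xi>. \<Sum>i\<in>I. f i \<xi>)"
proof (induction I rule: infinite_finite_induct)
  case (infinite I)
  then show ?case using trig_poly_monomial[of 0] by simp
next
  case empty
  then show ?case using trig_poly_monomial[of 0] by simp
next
  case (insert i I)
  then show ?case by (simp add: trig_poly_add)
qed

lemma rvec_add: "rvec (k + l) = rvec k + rvec l"
  by (simp add: rvec_def vec_eq_iff)

lemma trig_poly_mult:
  assumes "trig_poly f" "trig_poly g"
  shows "trig_poly (\<lambda>\<xi>. f \<xi> * g \<xi>)"
proof -
  obtain K h where K: "f = (\<lambda>\<xi>. \<Sum>k\<in>K. h k * echar (rvec k \<bullet> \<xi>))"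
    using assms(1) unfolding trig_poly_iff by blast
  obtain L l where L: "g = (\<lambda>\<xi>. \<Sum>k\<in>L. l k * echar (rvec k \<bullet> \<xi>))"
    using assms(2) unfolding trig_poly_iff by blast
  have "f \<xi> * g \<xi> = (\<Sum>i\<in>K. \<Sum>j\<in>L. (h i * l j) * echar (rvec (i + j) \<bullet> \<xi>))" for \<xi>
    unfolding K L sum_product by (simp add: rvec_add inner_add_left echar_add mult_ac)
  then show ?thesis
    by (simp add: trig_poly_sum trig_poly_monomial)
qed

lemma exp_sum_imp_trig_poly: "exp_sum (range rvec) f \<Longrightarrow> trig_poly f"
proof (induction rule: exp_sum.induct)
  case (const c)
  show ?case using trig_poly_monomial[of c 0] by (simp add: rvec_def zero_vec_def[symmetric])
next
  case (echar a)
  then show ?case using trig_poly_monomial[of 1] by auto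
qed (auto intro: trig_poly_add trig_poly_mult)

section \<open>Derivatives of powers of exponential sums\<close>

lemma exp_sum_has_partial_deriv:
  assumes "exp_sum A f"
  shows "\<exists>f'. exp_sum A f' \<and>
    (\<forall>x. ((\<lambda>t. f (x + t *\<^sub>R axis i 1)) has_vector_derivative f' x) (at 0))"
  using assms
proof induction
  case (const c)
  show ?case
    by (rule exI[of _ "\<lambda>_. 0"]) (auto intro: exp_sum.const)
next
  case (echar a)
  define c where "c = 2 * of_real pi * \<i> * of_real (a \<bullet> axis i 1)"
  have "((\<lambda>t. echar (a \<bullet> (x + t *\<^sub>R axis i 1))) has_vector_derivative c * echar (a \<bullet> x)) (at 0)" for x
  proof -
    have "((\<lambda>z. exp (2 * of_real pi * \<i> * of_real (a \<bullet> x) + c * z)) has_field_derivative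
        c * echar (a \<bullet> x)) (at (of_real 0))"
      by (auto intro!: derivative_eq_intros simp: echar_def)
    from has_vector_derivative_real_field[OF this]
    show ?thesis
      by (simp add: echar_def c_def inner_add_right ring_distribs mult_ac)
  qed
  moreover have "exp_sum A (\<lambda>x. c * echar (a \<bullet> x))"
    using echar by (intro exp_sum.intros)
  ultimately show ?case by blast
next
  case (add f g)
  then obtain f' g' where "exp_sum A f'" "exp_sum A g'"
    "\<And>x. ((\<lambda>t. f (x + t *\<^sub>R axis i 1)) has_vector_derivative f' x) (at 0)"
    "\<And>x. ((\<lambda>t. g (x + t *\<^sub>R axis i 1)) has_vector_derivative g' x) (at 0)"
    by blast
  then show ?case
    by (intro exI[of _ "\<lambda>x. f' x + g' x"] conjI allI exp_sum.add has_vector_derivative_add)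
next
  case (mult f g)
  then obtain f' g' where *: "exp_sum A f'" "exp_sum A g'"
    "\<And>x. ((\<lambda>t. f (x + t *\<^sub>R axis i 1)) has_vector_derivative f' x) (at 0)"
    "\<And>x. ((\<lambda>t. g (x + t *\<^sub>R axis i 1)) has_vector_derivative g' x) (at 0)"
    by blast
  have "((\<lambda>t. f (x + t *\<^sub>R axis i 1) * g (x + t *\<^sub>R axis i 1)) has_vector_derivative
      f x * g' x + f' x * g x) (at 0)" for x
    using has_vector_derivative_mult[OF *(3,4), of x x] by simp
  moreover have "exp_sum A (\<lambda>x. f x * g' x + f' x * g x)"
    by (intro exp_sum.intros mult *)
  ultimately show ?case by blast
qed

text \<open>The cofactor \<open>w\<close> is known only to be another exponential sum. This suffices for iterating the
  lemma, and for the order of vanishing only the exponent of \<open>g\<close> matters.\<close>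

lemma partial_deriv_mult_power:
  assumes "exp_sum A u" "exp_sum A g"
  shows "\<exists>w. exp_sum A w \<and> partial_deriv i (\<lambda>x. u x * g x ^ Suc k) = (\<lambda>x. w x * g x ^ k)"
proof -
  obtain u' where u': "exp_sum A u'"
    "\<And>x. ((\<lambda>t. u (x + t *\<^sub>R axis i 1)) has_vector_derivative u' x) (at 0)"
    using exp_sum_has_partial_deriv[OF assms(1)] by blast
  obtain g' where g': "exp_sum A g'"
    "\<And>x. ((\<lambda>t. g (x + t *\<^sub>R axis i 1)) has_vector_derivative g' x) (at 0)"
    using exp_sum_has_partial_deriv[OF assms(2)] by blast
  define w where "w x = u x * (of_nat (Suc k) * g' x) + u' x * g x" for x
  have pow: "((\<lambda>t. g (x + t *\<^sub>R axis i 1) ^ j) has_vector_derivative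
      of_nat j * g' x * g x ^ (j - 1)) (at 0)" for x j
  proof (induction j)
    case (Suc j)
    have "((\<lambda>t. g (x + t *\<^sub>R axis i 1) * g (x + t *\<^sub>R axis i 1) ^ j) has_vector_derivative
        g x * (of_nat j * g' x * g x ^ (j - 1)) + g' x * g x ^ j) (at 0)"
      using has_vector_derivative_mult[OF g'(2) Suc] by simp
    moreover have "g x * (of_nat j * g' x * g x ^ (j - 1)) + g' x * g x ^ j =
        of_nat (Suc j) * g' x * g x ^ j"
      by (cases j) (auto simp: algebra_simps)
    ultimately show ?case by simp
  qed simp
  have "((\<lambda>t. u (x + t *\<^sub>R axis i 1) * g (x + t *\<^sub>R axis i 1) ^ Suc k) has_vector_derivative
      w x * g x ^ k) (at 0)" for x
    using has_vector_derivative_mult[OF u'(2) pow[of x "Suc k"]]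
    by (simp add: w_def algebra_simps)
  then have "partial_deriv i (\<lambda>x. u x * g x ^ Suc k) = (\<lambda>x. w x * g x ^ k)"
    unfolding partial_deriv_def by (intro ext vector_derivative_at)
  moreover have "exp_sum A w"
    unfolding w_def by (intro exp_sum.intros assms u' g')
  ultimately show ?thesis by blast
qed

lemma partial_deriv_funpow_mult_power:
  assumes "exp_sum A u" "exp_sum A g"
  shows "\<exists>w. exp_sum A w \<and>
    (partial_deriv i ^^ j) (\<lambda>x. u x * g x ^ (j + k)) = (\<lambda>x. w x * g x ^ k)"
  using assms(1)
proof (induction j arbitrary: u)
  case 0
  then show ?case by auto
next
  case (Suc j)
  obtain w where w: "exp_sum A w"
    "partial_deriv i (\<lambda>x. u x * g x ^ Suc (j + k)) = (\<lambda>x. w x * g x ^ (j + k))"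
    using partial_deriv_mult_power[OF Suc.prems assms(2)] by blast
  then show ?case
    using Suc.IH[OF w(1)] by (simp add: funpow_Suc_right del: funpow.simps power_Suc)
qed

lemma foldr_partial_deriv_mult_power:
  assumes "exp_sum A u" "exp_sum A g"
  shows "\<exists>w. exp_sum A w \<and>
    foldr (\<lambda>i. partial_deriv i ^^ b i) cs (\<lambda>x. u x * g x ^ (sum_list (map b cs) + k)) =
      (\<lambda>x. w x * g x ^ k)"
proof (induction cs arbitrary: k)
  case Nil
  then show ?case using assms by auto
next
  case (Cons c cs)
  obtain w where w: "exp_sum A w"
    "foldr (\<lambda>i. partial_deriv i ^^ b i) cs
      (\<lambda>x. u x * g x ^ (sum_list (map b cs) + (b c + k))) = (\<lambda>x. w x * g x ^ (b c + k))"
    using Cons.IH[of "b c + k"] by blast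
  then show ?case
    using partial_deriv_funpow_mult_power[OF w(1) assms(2), where i = c and j = "b c" and k = k]
    by (simp add: add_ac)
qed

text \<open>Each of the fewer than \<open>N\<close> differentiations lowers the exponent of \<open>g\<close> by one, so the
  derivative still contains a factor \<open>g\<close>.\<close>

lemma mixed_deriv_power_eq_0:
  assumes "exp_sum A g" "g x = 0" "\<beta> \<in> multi_indices_below N"
  shows "mixed_deriv \<beta> (\<lambda>x. g x ^ N) x = 0"
proof -
  define S where "S = sum_list (map (($) \<beta>) coords)"
  have "S = (\<Sum>i\<in>UNIV. \<beta> $ i)"
    unfolding S_def using sum_list_distinct_conv_sum_set[OF coords(1)] coords(2) by metis
  then have "S < N"
    using assms(3) by (simp add: multi_indices_below_def)
  then obtain w where "mixed_deriv \<beta> (\<lambda>x. 1 * g x ^ (S + (N - S))) = (\<lambda>x. w x * g x ^ (N - S))"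
    using foldr_partial_deriv_mult_power[OF exp_sum.const[of A 1] assms(1),
        of "($) \<beta>" coords "N - S"]
    unfolding mixed_deriv_def S_def by blast
  then show ?thesis
    using \<open>S < N\<close> assms(2) by simp
qed

section \<open>Integer matrices acting on real vectors\<close>

lemma rmat_mult_rvec: "rmat E *v rvec k = rvec (E *v k)"
  by (simp add: rmat_def rvec_def map_matrix_def matrix_vector_mult_def vec_eq_iff)

lemma rmat_mult: "rmat (E ** F) = rmat E ** rmat F"
  by (simp add: rmat_def map_matrix_def matrix_matrix_mult_def vec_eq_iff)

lemma rmat_mat_1: "rmat (mat 1) = mat 1"
  by (simp add: rmat_def map_matrix_def mat_def vec_eq_iff)

lemma transpose_rmat: "transpose (rmat E) = rmat (transpose E)"
  by (simp add: rmat_def map_matrix_def transpose_def vec_eq_iff)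

lemma det_rmat: "det (rmat E) = of_int (det E)"
  by (simp add: det_def rmat_def map_matrix_def)

lemma inner_rvec_Ints: "rvec k \<bullet> rvec l \<in> \<int>"
  by (auto simp: inner_vec_def rvec_def intro!: Ints_sum Ints_mult)

section \<open>Character sums over digit sets\<close>

text \<open>Translation by an integer vector \<open>l\<close> permutes the cosets of \<open>M\<int>\<^sup>d\<close>, so a sum over digits of a
  function on the quotient is invariant under it.\<close>

lemma digit_set_sum_shift:
  assumes "digit_set M D"
    and per: "\<And>x k. f (x + M *v k) = f x"
  shows "(\<Sum>x\<in>D. f (x + l)) = (\<Sum>x\<in>D. f x)"
proof -
  have uniq: "x = y" if "x \<in> D" "y \<in> D" "x - y = M *v k" for x y k
  proof -
    have "\<exists>k. x - x = M *v k" by (intro exI[of _ 0]) simp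
    then show ?thesis
      using assms(1) that unfolding digit_set_def by metis
  qed
  have "\<exists>r. \<forall>x. r x \<in> D \<and> (\<exists>k. x - r x = M *v k)"
    using assms(1) unfolding digit_set_def by metis
  then obtain r where r: "\<And>x. r x \<in> D" "\<And>x. \<exists>k. x - r x = M *v k"
    by blast
  have f_r: "f (r x) = f x" for x
  proof -
    obtain k where "x - r x = M *v k" using r by blast
    then have "x = r x + M *v k" by (simp add: algebra_simps)
    then show ?thesis using per by metis
  qed
  have inj: "x = r (y + c)" if x: "x \<in> D" and y: "y = r (x - c)" for x y c
  proof -
    obtain k where k: "(x - c) - r (x - c) = M *v k" using r by blast
    obtain k' where k': "(y + c) - r (y + c) = M *v k'" using r by blast
    have "x - r (y + c) = M *v (k + k')"
      unfolding matrix_vector_right_distrib k[symmetric] k'[symmetric] y by simp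
    then show ?thesis using uniq x r(1) by blast
  qed
  have "(\<Sum>x\<in>D. f (x + l)) = (\<Sum>x\<in>D. f (r (x + l)))"
    by (simp add: f_r)
  also have "\<dots> = (\<Sum>x\<in>D. f x)"
    by (rule sum.reindex_bij_witness[of _ "\<lambda>x. r (x - l)" "\<lambda>x. r (x + l)"])
      (use inj[of _ _ l] inj[of _ _ "- l"] r in auto)
  finally show ?thesis .
qed

text \<open>Some coordinate of \<open>y\<close> is not an integer, since otherwise \<open>v\<close> would lie in the image of the
  integer lattice. The unit translation along that coordinate multiplies the sum by a factor other
  than 1, yet it leaves the sum unchanged because it only permutes the cosets.\<close>

lemma digit_sum_eq_0:
  assumes D: "digit_set M D"
    and y: "transpose (rmat M) *v y = rvec v"
    and v: "\<nexists>k. v = transpose M *v k"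
  shows "(\<Sum>x\<in>D. echar (rvec x \<bullet> y)) = 0"
proof -
  have "\<exists>i. y $ i \<notin> \<int>"
  proof (rule ccontr)
    assume "\<nexists>i. y $ i \<notin> \<int>"
    then have "y = rvec (vfloor y)"
      by (auto simp: rvec_def vfloor_def vec_eq_iff)
    then have "rvec v = rvec (transpose M *v vfloor y)"
      using y by (metis transpose_rmat rmat_mult_rvec)
    then show False
      using v by (auto simp: rvec_def vec_eq_iff)
  qed
  then obtain i where i: "y $ i \<notin> \<int>" by blast
  define l :: "int ^ 'a" where "l = axis i 1"
  have "rvec l = axis i 1"
    by (simp add: l_def rvec_def axis_def vec_eq_iff)
  then have l: "echar (rvec l \<bullet> y) \<noteq> 1"
    using i by (simp add: echar_eq_1_iff inner_axis')
  have "echar (rvec (x + M *v k) \<bullet> y) = echar (rvec x \<bullet> y)" for x k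
  proof -
    have "rvec (M *v k) \<bullet> y = rvec k \<bullet> rvec v"
      unfolding rmat_mult_rvec[symmetric] y[symmetric] transpose_matrix_vector
      by (metis dot_lmul_matrix inner_commute)
    then have "echar (rvec (M *v k) \<bullet> y) = 1"
      using inner_rvec_Ints by (simp add: echar_eq_1_iff)
    then show ?thesis
      by (simp add: rvec_add inner_add_left echar_add)
  qed
  from digit_set_sum_shift[OF D, of "\<lambda>x. echar (rvec x \<bullet> y)", OF this, of l]
  have "(\<Sum>x\<in>D. echar (rvec x \<bullet> y)) * echar (rvec l \<bullet> y) = (\<Sum>x\<in>D. echar (rvec x \<bullet> y))"
    by (simp add: rvec_add inner_add_left echar_add sum_distrib_right)
  then show ?thesis using l by (metis mult_cancel_left1 mult.commute)
qed

lemma nonzero_digit_not_in_image: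
  assumes "digit_set A D" "0 \<in> D" "v \<in> D" "v \<noteq> 0"
  shows "\<nexists>k. v = A *v k"
proof
  assume "\<exists>k. v = A *v k"
  moreover have "\<exists>k. v - v = A *v k" by (intro exI[of _ 0]) simp
  ultimately show False
    using assms unfolding digit_set_def by (metis diff_zero)
qed

section \<open>Symmetrization\<close>

lemma H_symmetric_prod:
  assumes "symmetry_group H"
  shows "H_symmetric H (\<lambda>\<xi>. \<Prod>E\<in>H. f (transpose (rmat E) *v \<xi>))"
  unfolding H_symmetric_def
proof (intro ballI allI)
  fix F \<xi> assume F: "F \<in> H"
  let ?G = "\<lparr>carrier = H, monoid.mult = (**), one = mat 1\<rparr>"
  interpret group ?G
    using assms by (simp add: symmetry_group_def)
  have "bij_betw (\<lambda>E. F ** E) H H"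
    using inj_on_cmult[of F] surj_const_mult[of F] F by (simp add: bij_betw_def)
  then have "(\<Prod>E\<in>H. f (transpose (rmat E) *v \<xi>)) =
      (\<Prod>E\<in>H. f (transpose (rmat (F ** E)) *v \<xi>))"
    by (rule prod.reindex_bij_betw[symmetric])
  also have "\<dots> = (\<Prod>E\<in>H. f (transpose (rmat E) *v (transpose (rmat F) *v \<xi>)))"
    by (simp only: rmat_mult matrix_transpose_mul matrix_vector_mul_assoc)
  finally show "(\<Prod>E\<in>H. f (transpose (rmat E) *v \<xi>)) =
      (\<Prod>E\<in>H. f (transpose (rmat E) *v (transpose (rmat F) *v \<xi>)))" .
qed

section \<open>Existence of the masks\<close>

theorem theorem31:
  fixes n m :: nat
    and H :: "(int ^ 'd ^ 'd) set"
    and M :: "int ^ 'd ^ 'd"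
    and s :: "nat \<Rightarrow> int ^ 'd"
  assumes "symmetry_group H"
    and "matrix_dilation M"
    and "m = nat \<bar>det M\<bar>"
    and "digit_set M (s ` {..<m})"
    and "\<forall>E\<in>H. rmat M ** rmat E ** matrix_inv (rmat M) \<in> rmat ` H"
    and "\<forall>E\<in>H. \<forall>j<m. \<exists>r. E *v s j = M *v r + s j"
    and "\<forall>j<m. digit_shift M (s j) \<in> semi_integer_shifts \<and>
           (\<forall>E\<in>H. \<forall>t. semi_trig_poly (digit_shift M (s j)) t \<longrightarrow>
              semi_trig_poly (digit_shift M (s j)) (\<lambda>\<xi>. t (transpose (rmat E) *v \<xi>)))"
  shows "\<exists>m0 m0'. mask m0 \<and> mask m0' \<and> H_symmetric H m0 \<and> H_symmetric H m0' \<and>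
           sum_rule n M m0 \<and>
           (\<forall>\<beta>\<in>multi_indices_below n. mixed_deriv \<beta> (\<lambda>\<xi>. 1 - m0 \<xi> * cnj (m0' \<xi>)) 0 = 0)"
proof -
  define D where "D = s ` {..<m}"
  have D: "digit_set M D" "finite D"
    using assms(4) by (simp_all add: D_def)
  have "D \<noteq> {}"
    using D(1) by (auto simp: digit_set_def)
  \<comment> \<open>A singular \<open>M\<close> would leave no digits at all.\<close>
  then have "det M \<noteq> 0"
    using assms(3) by (auto simp: D_def)
  then have "invertible (transpose (rmat M))"
    by (simp add: invertible_det_nz det_rmat)
  then have inv: "transpose (rmat M) ** matrix_inv (transpose (rmat M)) = mat 1"
    unfolding invertible_def matrix_inv_def by (rule someI_ex[THEN conjunct1])

  define Q where "Q \<xi> = (\<Sum>x\<in>D. echar (rvec x \<bullet> \<xi>)) / of_nat (card D)" for \<xi> :: "real ^ 'd"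
  define P where "P \<xi> = (\<Prod>E\<in>H. Q (transpose (rmat E) *v \<xi>))" for \<xi>
  define m0 where "m0 \<xi> = P \<xi> ^ n" for \<xi>
  \<comment> \<open>The upper limit \<open>n\<close> instead of \<open>n - 1\<close> keeps the value 1 at the origin when \<open>n = 0\<close>.\<close>
  define m0' where "m0' \<xi> = cnj (\<Sum>k\<le>n. (1 - m0 \<xi>) ^ k)" for \<xi>

  let ?Z = "range rvec :: (real ^ 'd) set"
  have "exp_sum ?Z (\<lambda>\<xi>. (1 / of_nat (card D)) * (\<Sum>x\<in>D. echar (rvec x \<bullet> \<xi>)))"
    by (intro exp_sum.mult exp_sum.const exp_sum_sum exp_sum.echar) auto
  then have Q: "exp_sum ?Z Q"
    by (simp add: Q_def[abs_def])
  have P: "exp_sum ?Z P"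
    unfolding P_def
    by (intro exp_sum_prod exp_sum_compose_linear[OF Q]) (auto simp: rmat_mult_rvec)
  have m0: "exp_sum ?Z m0"
    unfolding m0_def by (intro exp_sum_power P)
  have one_minus: "exp_sum ?Z (\<lambda>\<xi>. 1 - m0 \<xi>)"
    by (intro exp_sum_diff exp_sum.const m0)
  have uminus_Z: "- a \<in> ?Z" if "a \<in> ?Z" for a
  proof -
    from that obtain k where "a = rvec k" by blast
    then have "- a = rvec (- k)" by (simp add: rvec_def vec_eq_iff)
    then show ?thesis by blast
  qed
  have m0': "exp_sum ?Z m0'"
    unfolding m0'_def by (intro exp_sum_cnj exp_sum_sum exp_sum_power one_minus uminus_Z)

  have "Q 0 = 1"
    using \<open>D \<noteq> {}\<close> D(2) by (simp add: Q_def)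
  then have m0_0: "m0 0 = 1"
    by (simp add: m0_def P_def)
  then have m0'_0: "m0' 0 = 1"
    by (simp add: m0'_def power_0_left)

  have "H_symmetric H P"
    using H_symmetric_prod[OF assms(1), of Q] by (simp add: P_def[abs_def])
  then have sym: "H_symmetric H m0" "H_symmetric H m0'"
    unfolding H_symmetric_def m0_def m0'_def by metis+

  have "sum_rule n M m0"
    unfolding sum_rule_def
  proof (intro allI impI ballI)
    fix D' v and \<beta> :: "nat ^ 'd"
    assume D': "digit_set (transpose M) D' \<and> 0 \<in> D'" and v: "v \<in> D' - {0}"
      and \<beta>: "\<beta> \<in> multi_indices_below n"
    let ?L = "matrix_inv (transpose (rmat M))"
    have "transpose (rmat M) *v (?L *v rvec v) = rvec v"
      by (simp add: matrix_vector_mul_assoc inv)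
    moreover have "\<nexists>k. v = transpose M *v k"
      using nonzero_digit_not_in_image D' v by blast
    ultimately have "Q (?L *v rvec v) = 0"
      unfolding Q_def using digit_sum_eq_0[OF D(1)] by simp
    moreover have "finite H" "mat 1 \<in> H"
      using assms(1) monoid.one_closed[OF group.is_monoid,
          of "\<lparr>carrier = H, monoid.mult = (**), one = mat 1\<rparr>"]
      by (simp_all add: symmetry_group_def)
    ultimately have "P (?L *v rvec v) = 0"
      unfolding P_def by (intro prod_zero) (auto intro!: bexI[of _ "mat 1"] simp: rmat_mat_1)
    moreover have "exp_sum UNIV (\<lambda>\<xi>. P (?L *v \<xi>))"
      by (rule exp_sum_compose_linear[OF P]) simp
    ultimately show "mixed_deriv \<beta> (\<lambda>\<xi>. m0 (?L *v \<xi>)) (rvec v) = 0"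
      unfolding m0_def using \<beta> by (intro mixed_deriv_power_eq_0)
  qed

  moreover have "mixed_deriv \<beta> (\<lambda>\<xi>. 1 - m0 \<xi> * cnj (m0' \<xi>)) 0 = 0"
    if "\<beta> \<in> multi_indices_below n" for \<beta>
  proof -
    have "1 - m0 \<xi> * cnj (m0' \<xi>) = (1 - m0 \<xi>) ^ Suc n" for \<xi>
      using one_diff_power_eq[of "1 - m0 \<xi>" "Suc n"]
      by (simp add: m0'_def lessThan_Suc_atMost algebra_simps)
    moreover have "\<beta> \<in> multi_indices_below (Suc n)"
      using that by (simp add: multi_indices_below_def)
    ultimately show ?thesis
      using mixed_deriv_power_eq_0[OF one_minus, of 0 \<beta> "Suc n"] m0_0 by (simp del: power_Suc)
  qed

  ultimately show ?thesis
    using exp_sum_imp_trig_poly[OF m0] exp_sum_imp_trig_poly[OF m0'] m0_0 m0'_0 sym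
    unfolding mask_def by blast
qed

end
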